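(* Let $C$ be a nonempty closed convex subset of a real Hilbert space $H$. Let $T:C\to C$ be a $\kappa$-strict pseudo-contraction for some $0\le\kappa<1$ such that $F(T)\ne\emptyset$, and let $L$ be a Lipschitz constant of $T$. Suppose $\{\alpha_n\}_{n\ge0}$ and $\{\beta_n\}_{n\ge0}$ are two real sequences in $[0,1]$ satisfying, for all $n$ and some constants $\alpha',\alpha$, $$0<\alpha'\le\alpha_n\le\alpha<\frac{2}{\sqrt{4\kappa L^2+(\kappa+1)^2}+(\kappa+1)}\quad\text{and}\quad 0<\beta_n\le\kappa\alpha_n+(1-\kappa).$$ Let $x_0\in C$ be arbitrary and let $\{x_n\}$ be generated, for $n\ge0$, by $$v_n=(1-\alpha_n)x_n+\alpha_nTx_n,\qquad y_n=(1-\beta_n)x_n+\beta_nTv_n,$$ $$C_n=\{z\in C:\|y_n-z\|^2\le\|x_n-z\|^2-\alpha_n\beta_n(1-(\kappa+1)\alpha_n-\kappa L^2\alpha_n^2)\|x_n-Tx_n\|^2\},$$ $$Q_n=\{z\in C:\langle z-x_n,x_n-x_0\rangle\ge0\},$$ $$x_{n+1}=P_{C_n^*\cap Q_n}x_0,$$ where $C_n^*$ is a closed convex set with $F(T)\subset C_n^*\subset C_n$. Then $\{x_n\}$ converges strongly to the fixed point $P_{F(T)}x_0$.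
   Context: $F(T)=\{x\in C:Tx=x\}$. $T$ is a $\kappa$-strict pseudo-contraction if $\|Tx-Ty\|^2\le\|x-y\|^2+\kappa\|(I-T)x-(I-T)y\|^2$ for all $x,y\in C$ ($I$ the identity); such a mapping is Lipschitz. $L$ is a Lipschitz constant of $T$ if $\|Tx-Ty\|\le L\|x-y\|$ for all $x,y\in C$. For a nonempty closed convex set $D\subset H$, $P_D$ is the metric projection (nearest-point map) onto $D$. *)

theory Defs
  imports "HOL-Analysis.Analysis"
begin

definition fixed_points :: "'a set \<Rightarrow> ('a \<Rightarrow> 'a) \<Rightarrow> 'a set" where
  "fixed_points C T = {x \<in> C. T x = x}"

definition strict_pseudo_contraction ::
  "real \<Rightarrow> 'a::real_inner set \<Rightarrow> ('a \<Rightarrow> 'a) \<Rightarrow> bool" where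
  "strict_pseudo_contraction \<kappa> C T \<longleftrightarrow>
     (\<forall>x\<in>C. \<forall>y\<in>C. (norm (T x - T y))\<^sup>2 \<le>
        (norm (x - y))\<^sup>2 + \<kappa> * (norm ((x - T x) - (y - T y)))\<^sup>2)"

(* The library's closest_point is restricted to heine_borel types, i.e. to the
   finite-dimensional situation.  On a nonempty closed convex subset D of a Hilbert
   space the nearest point exists and is unique, so the description is proper there. *)
definition metric_projection :: "'a::real_inner set \<Rightarrow> 'a \<Rightarrow> 'a" where
  "metric_projection D a = (THE p. p \<in> D \<and> (\<forall>z\<in>D. dist a p \<le> dist a z))"

end

theory Submission
  imports Defs
begin

text \<open>
  The set \<open>Q\<^sub>n\<close> is cut out of \<open>C\<close> by a half-space whose nearest point to \<open>x\<^sub>0\<close> is \<open>x\<^sub>n\<close>.  It contains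
  \<open>F = fixed_points C T\<close>, since the variational inequality for one projection puts \<open>F\<close> into the next
  half-space.  By Pythagoras, every \<open>z\<close> in \<open>Q\<^sub>n\<close> satisfies
  \<open>\<parallel>z - x\<^sub>n\<parallel>\<^sup>2 \<le> \<parallel>z - x\<^sub>0\<parallel>\<^sup>2 - \<parallel>x\<^sub>n - x\<^sub>0\<parallel>\<^sup>2\<close>.  Applied to the next iterate, this makes the distances
  \<open>\<parallel>x\<^sub>n - x\<^sub>0\<parallel>\<close> increase and the steps tend to zero; applied to the projection \<open>p\<close> of \<open>x\<^sub>0\<close> onto \<open>F\<close>,
  it bounds these distances by \<open>\<parallel>p - x\<^sub>0\<parallel>\<close> and reduces the theorem to showing that their limit
  \<open>r\<close> is at least \<open>\<parallel>p - x\<^sub>0\<parallel>\<close>, that is, to finding a fixed point within distance \<open>r\<close> of \<open>x\<^sub>0\<close>.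

  That the next iterate lies in \<open>C\<^sub>n\<close> bounds the residual \<open>\<parallel>x\<^sub>n - T x\<^sub>n\<parallel>\<close> by a constant multiple of
  the step (\<open>residual_le_step\<close>).  The parameters \<open>\<beta>\<^sub>n\<close> may tend to zero, but the inequality defining
  \<open>C\<^sub>n\<close> can be divided by \<open>\<beta>\<^sub>n\<close>, so they do not enter the constant.  Hence the iterates are
  asymptotically fixed, and \<open>approximate_fixed_points_imp_fixed_point\<close> supplies the desired point.

  The last step replaces weak compactness and demiclosedness by two facts.  The closed convex hulls
  of the tails of a bounded sequence have a common point
  (\<open>decreasing_closed_convex_Inter_nonempty\<close>).  Since \<open>I - T\<close> is monotone and continuous, being
  a fixed point is equivalent to a family of affine inequalities (Minty's characterization); an
  asymptotically fixed sequence satisfies these up to an error tending to zero, and affine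
  inequalities pass to closed convex hulls.
\<close>

section \<open>Metric projections in Hilbert spaces\<close>

text \<open>
  This is the part of weak compactness used below.  Almost nearest points of the sets to any
  one point \<open>a\<close> form a Cauchy sequence: the distances \<open>d\<close> from \<open>a\<close> to the sets increase to a finite
  limit, and midpoints of later almost nearest points stay in the earlier sets, so the
  parallelogram law applies.
\<close>
lemma decreasing_closed_convex_Inter_nonempty:
  fixes K :: "nat \<Rightarrow> 'a::{real_inner, complete_space} set"
  assumes closed: "\<And>n. closed (K n)" and convex: "\<And>n. convex (K n)"
    and nonempty: "\<And>n. K n \<noteq> {}" and decreasing: "decseq K" and bounded: "bounded (K 0)"
  shows "(\<Inter>n. K n) \<noteq> {}"
proof -
  obtain a where "a \<in> K 0"
    using nonempty[of 0] by blast
  define d where "d n = infdist a (K n)" for n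
  have antimono: "K m \<subseteq> K n" if "n \<le> m" for n m
    using decreasing that by (auto simp: decseq_def)
  have d_le: "d n \<le> dist a q" if "q \<in> K n" for n q
    unfolding d_def using that by (rule infdist_le)
  have inc: "incseq d"
    unfolding incseq_def d_def
    using antimono nonempty by (intro allI impI infdist_mono) auto
  obtain R where R: "\<And>q. q \<in> K 0 \<Longrightarrow> dist a q \<le> R"
    using bounded bounded_any_center[of "K 0" a] by auto
  have d_bound: "d n \<le> R" for n
    using nonempty[of n] d_le[of _ n] R antimono[of 0 n] by fastforce
  obtain D where lim: "d \<longlonglongrightarrow> D" and d_le_D: "\<And>n. d n \<le> D"
    using incseq_convergent[OF inc] d_bound by auto
  have d_nonneg: "0 \<le> d n" for n
    unfolding d_def by (rule infdist_nonneg)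
  define e :: "nat \<Rightarrow> real" where "e n = inverse (real (Suc n))" for n
  have e_pos: "0 < e n" for n
    by (simp add: e_def)
  have e_antimono: "e m \<le> e n" if "n \<le> m" for n m
    using that by (simp add: e_def field_simps)
  have e_lim: "e \<longlonglongrightarrow> 0"
    unfolding e_def by (rule LIMSEQ_inverse_real_of_nat)
  have "\<exists>q\<in>K n. dist a q < d n + e n" for n
  proof -
    have "(INF q\<in>K n. dist a q) < d n + e n"
      using nonempty[of n] e_pos[of n] by (simp add: d_def infdist_def)
    then show ?thesis
      using nonempty[of n] by (subst (asm) cINF_less_iff) auto
  qed
  then obtain q where q: "\<And>n. q n \<in> K n" and q_dist: "\<And>n. dist a (q n) < d n + e n"
    by metis
  have close: "(dist (q n) (q m))\<^sup>2 \<le> 4 * (D + e N)\<^sup>2 - 4 * (d N)\<^sup>2" if "N \<le> n" "N \<le> m" for N n m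
  proof -
    have "midpoint (q n) (q m) \<in> K N"
      using q antimono that convex[of N]
      by (metis (no_types, lifting) closed_segment_subset midpoint_in_closed_segment subsetD)
    then have "(d N)\<^sup>2 \<le> (norm (a - midpoint (q n) (q m)))\<^sup>2"
      using d_le d_nonneg by (metis dist_norm power_mono)
    moreover have "(norm (a - q k))\<^sup>2 \<le> (D + e N)\<^sup>2" if "N \<le> k" for k
      using q_dist[of k] d_le_D[of k] e_antimono[OF that]
      by (intro power_mono) (auto simp: dist_norm)
    moreover have "(norm (q n - q m))\<^sup>2 = 2 * (norm (a - q n))\<^sup>2 + 2 * (norm (a - q m))\<^sup>2
        - 4 * (norm (a - midpoint (q n) (q m)))\<^sup>2"
      by (simp add: midpoint_def power2_norm_eq_inner inner_diff_left inner_diff_right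
          inner_add_left inner_add_right inner_commute algebra_simps)
    ultimately show ?thesis
      using that unfolding dist_norm by smt
  qed
  have gap: "(\<lambda>N. 4 * (D + e N)\<^sup>2 - 4 * (d N)\<^sup>2) \<longlonglongrightarrow> 4 * (D + 0)\<^sup>2 - 4 * D\<^sup>2"
    by (intro tendsto_intros lim e_lim)
  have "Cauchy q"
  proof (rule metric_CauchyI)
    fix r :: real assume "0 < r"
    then have "\<forall>\<^sub>F N in sequentially. 4 * (D + e N)\<^sup>2 - 4 * (d N)\<^sup>2 < r\<^sup>2"
      using gap by (intro order_tendstoD(2)) auto
    then obtain N where "4 * (D + e N)\<^sup>2 - 4 * (d N)\<^sup>2 < r\<^sup>2"
      by (auto simp: eventually_sequentially)
    then show "\<exists>M. \<forall>m\<ge>M. \<forall>n\<ge>M. dist (q m) (q n) < r"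
      using close[of N] \<open>0 < r\<close> by (meson le_less_trans less_imp_le power_less_imp_less_base)
  qed
  then obtain w where w: "q \<longlonglongrightarrow> w"
    using Cauchy_convergent convergent_def by blast
  have "w \<in> K n" for n
  proof (rule Lim_in_closed_set[OF closed _ _ w])
    show "\<forall>\<^sub>F k in sequentially. q k \<in> K n"
      by (rule eventually_sequentiallyI[of n]) (rule subsetD[OF antimono q])
  qed auto
  then show ?thesis
    by auto
qed

text \<open>
  A nearest point is a common point of the sets of almost nearest points.
\<close>
lemma nearest_point_exists:
  fixes D :: "'a::{real_inner, complete_space} set"
  assumes "closed D" and "convex D" and "D \<noteq> {}"
  shows "\<exists>p\<in>D. \<forall>z\<in>D. dist a p \<le> dist a z"
proof -
  define d where "d = infdist a D"
  define K where "K n = D \<inter> cball a (d + inverse (real (Suc n)))" for n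
  have "(\<Inter>n. K n) \<noteq> {}"
  proof (rule decreasing_closed_convex_Inter_nonempty)
    fix n
    show "closed (K n)" "convex (K n)"
      using assms by (auto simp: K_def convex_Int)
    have "(INF q\<in>D. dist a q) < d + inverse (real (Suc n))"
      using assms by (simp add: d_def infdist_def)
    then show "K n \<noteq> {}"
      using assms by (subst (asm) cINF_less_iff) (auto simp: K_def intro: less_imp_le)
  next
    show "decseq K"
      unfolding decseq_def K_def
      by (intro allI impI Int_mono order_refl subset_cball add_left_mono) (simp add: field_simps)
    show "bounded (K 0)"
      unfolding K_def by (rule bounded_subset[OF bounded_cball]) auto
  qed
  then obtain p where p: "\<And>n. p \<in> K n"
    by auto
  have "(\<lambda>n. d + inverse (real (Suc n))) \<longlonglongrightarrow> d + 0"
    by (intro tendsto_intros LIMSEQ_inverse_real_of_nat)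
  then have "dist a p \<le> d"
    using p by (intro LIMSEQ_le_const[of _ d]) (auto simp: K_def)
  then show ?thesis
    using p[of 0] by (auto simp: K_def d_def intro: order_trans[OF _ infdist_le])
qed

lemma metric_projection:
  fixes D :: "'a::{real_inner, complete_space} set"
  assumes "closed D" and "convex D" and "D \<noteq> {}"
  shows metric_projection_in: "metric_projection D a \<in> D"
    and metric_projection_le: "z \<in> D \<Longrightarrow> dist a (metric_projection D a) \<le> dist a z"
proof -
  have "\<exists>!p. p \<in> D \<and> (\<forall>z\<in>D. dist a p \<le> dist a z)"
    using nearest_point_exists[OF assms, of a] any_closest_point_unique[OF assms(2,1)] by blast
  from theI'[OF this]
  show "metric_projection D a \<in> D" "z \<in> D \<Longrightarrow> dist a (metric_projection D a) \<le> dist a z"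
    by (auto simp: metric_projection_def)
qed

lemma metric_projection_inner:
  fixes D :: "'a::{real_inner, complete_space} set"
  assumes "closed D" and "convex D" and "z \<in> D"
  shows "0 \<le> inner (z - metric_projection D a) (metric_projection D a - a)"
proof -
  have "inner (a - metric_projection D a) (z - metric_projection D a) \<le> 0"
    using assms metric_projection[OF assms(1,2)] by (intro any_closest_point_dot) auto
  then show ?thesis
    by (simp add: inner_commute inner_diff_left inner_diff_right)
qed

section \<open>Fixed points of strict pseudo-contractions\<close>

text \<open>
  Writing \<open>g\<close> for the difference of the residuals, expand
  \<open>\<parallel>T x - T y\<parallel>\<^sup>2 = \<parallel>(x - y) - g\<parallel>\<^sup>2\<close>: for \<open>\<kappa> \<le> 1\<close> the term in \<open>\<parallel>g\<parallel>\<^sup>2\<close> absorbs the defect,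
  and what remains says that \<open>I - T\<close> is a monotone operator.
\<close>
lemma strict_pseudo_contraction_monotone:
  assumes "strict_pseudo_contraction \<kappa> C T" and "\<kappa> \<le> 1" and "x \<in> C" and "y \<in> C"
  shows "0 \<le> inner ((x - T x) - (y - T y)) (x - y)"
proof -
  define g where "g = (x - T x) - (y - T y)"
  have "(norm (T x - T y))\<^sup>2 \<le> (norm (x - y))\<^sup>2 + \<kappa> * (norm g)\<^sup>2"
    using assms unfolding strict_pseudo_contraction_def g_def by blast
  also have "\<dots> \<le> (norm (x - y))\<^sup>2 + (norm g)\<^sup>2"
    using mult_right_mono[OF assms(2) zero_le_power2[of "norm g"]] by simp
  finally have "(norm (T x - T y))\<^sup>2 \<le> (norm (x - y))\<^sup>2 + (norm g)\<^sup>2" .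
  moreover have "T x - T y = (x - y) - g"
    by (simp add: g_def)
  ultimately show ?thesis
    unfolding g_def[symmetric]
    by (simp add: power2_norm_eq_inner inner_diff_left inner_diff_right inner_commute)
qed

text \<open>
  Minty's trick: test the hypothesis at points \<open>z\<close> of the segment from \<open>w\<close> to \<open>T w\<close>, divide
  by the length parameter, and let \<open>z\<close> tend to \<open>w\<close>.  The limit is \<open>\<parallel>w - T w\<parallel>\<^sup>2 \<le> 0\<close>.
\<close>
lemma fixed_pointI_Minty:
  fixes T :: "'a::real_inner \<Rightarrow> 'a"
  assumes "convex C" and "T \<in> C \<rightarrow> C" and cont: "continuous_on C T" and "w \<in> C"
    and Minty: "\<And>z. z \<in> C \<Longrightarrow> inner (z - T z) (w - z) \<le> 0"
  shows "w \<in> fixed_points C T"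
proof -
  define e :: "nat \<Rightarrow> real" where "e n = inverse (real (Suc n))" for n
  define z where "z n = w + e n *\<^sub>R (T w - w)" for n
  have e: "0 < e n" "e n \<le> 1" for n
    by (auto simp: e_def field_simps)
  have z_in: "z n \<in> C" for n
  proof -
    have "z n = (1 - e n) *\<^sub>R w + e n *\<^sub>R T w"
      by (simp add: z_def algebra_simps)
    then show ?thesis
      using assms e[of n] by (auto intro!: convexD)
  qed
  have "z \<longlonglongrightarrow> w + 0 *\<^sub>R (T w - w)"
    unfolding z_def e_def by (intro tendsto_intros LIMSEQ_inverse_real_of_nat)
  then have z_lim: "z \<longlonglongrightarrow> w"
    by simp
  then have "(\<lambda>n. T (z n)) \<longlonglongrightarrow> T w"
    using cont z_in \<open>w \<in> C\<close> by (auto intro: continuous_on_tendsto_compose)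
  then have "(\<lambda>n. inner (z n - T (z n)) (w - T w)) \<longlonglongrightarrow> inner (w - T w) (w - T w)"
    by (intro tendsto_intros z_lim)
  moreover have "inner (z n - T (z n)) (w - T w) \<le> 0" for n
  proof -
    have "w - z n = e n *\<^sub>R (w - T w)"
      by (simp add: z_def algebra_simps)
    then show ?thesis
      using Minty[OF z_in, of n] e[of n] by (simp add: mult_le_0_iff)
  qed
  ultimately have "inner (w - T w) (w - T w) \<le> 0"
    by (intro LIMSEQ_le_const2) auto
  then show ?thesis
    using \<open>w \<in> C\<close> by (simp add: fixed_points_def inner_gt_zero_iff flip: not_less)
qed

text \<open>
  Exhibiting the fixed points as an intersection of half-spaces makes the closedness and the
  convexity of their set evident, so that the projection onto it is meaningful.
\<close>
lemma fixed_points_eq_Minty: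
  fixes T :: "'a::real_inner \<Rightarrow> 'a"
  assumes "convex C" and "T \<in> C \<rightarrow> C" and "continuous_on C T"
    and "strict_pseudo_contraction \<kappa> C T" and "\<kappa> \<le> 1"
  shows "fixed_points C T = C \<inter> (\<Inter>z\<in>C. {w. inner (z - T z) w \<le> inner (z - T z) z})"
proof (intro equalityI subsetI)
  fix w assume "w \<in> fixed_points C T"
  then have w: "w \<in> C" "T w = w"
    by (auto simp: fixed_points_def)
  have "inner (z - T z) w \<le> inner (z - T z) z" if "z \<in> C" for z
    using strict_pseudo_contraction_monotone[OF assms(4,5) that w(1)] w(2)
    by (simp add: inner_diff_right)
  then show "w \<in> C \<inter> (\<Inter>z\<in>C. {w. inner (z - T z) w \<le> inner (z - T z) z})"
    using w by auto
next
  fix w assume w: "w \<in> C \<inter> (\<Inter>z\<in>C. {w. inner (z - T z) w \<le> inner (z - T z) z})"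
  show "w \<in> fixed_points C T"
  proof (rule fixed_pointI_Minty[OF assms(1-3)])
    show "w \<in> C"
      using w by simp
    fix z assume "z \<in> C"
    then show "inner (z - T z) (w - z) \<le> 0"
      using w by (simp add: inner_diff_right)
  qed
qed

lemma closed_convex_fixed_points:
  fixes T :: "'a::real_inner \<Rightarrow> 'a"
  assumes "closed C" and "convex C" and "T \<in> C \<rightarrow> C" and "continuous_on C T"
    and "strict_pseudo_contraction \<kappa> C T" and "\<kappa> \<le> 1"
  shows "closed (fixed_points C T)" and "convex (fixed_points C T)"
  unfolding fixed_points_eq_Minty[OF assms(2-6)]
  using assms(1,2)
  by (auto intro!: closed_Int closed_INT convex_Int convex_INT
      closed_halfspace_le convex_halfspace_le)

text \<open>
  Any common point of the closed convex hulls of the tails will do.  For fixed \<open>z\<close>,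
  monotonicity bounds \<open>inner (z - T z) (x n - z)\<close> by \<open>inner (x n - T (x n)) (x n - z)\<close>, which tends
  to zero.  So from some index on the sequence lies in the half-space where the Minty inequality
  at \<open>z\<close> holds up to \<open>e\<close>, and with it the hull of that tail; the ball around \<open>a\<close> is inherited in
  the same way.
\<close>
lemma approximate_fixed_points_imp_fixed_point:
  fixes T :: "'a::{real_inner, complete_space} \<Rightarrow> 'a"
  assumes C: "closed C" "convex C" and T: "T \<in> C \<rightarrow> C" "continuous_on C T"
    and spc: "strict_pseudo_contraction \<kappa> C T" "\<kappa> \<le> 1"
    and x_in: "\<And>n. x n \<in> C" and bounded: "\<And>n. dist a (x n) \<le> r"
    and asymp: "(\<lambda>n. x n - T (x n)) \<longlonglongrightarrow> 0"
  shows "\<exists>w\<in>fixed_points C T. dist a w \<le> r"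
proof -
  define K where "K n = closure (convex hull (x ` {n..}))" for n
  have K_minimal: "K n \<subseteq> S" if "closed S" "convex S" "\<And>k. n \<le> k \<Longrightarrow> x k \<in> S" for n S
    unfolding K_def using that by (intro closure_minimal hull_minimal) auto
  have K_subset: "K n \<subseteq> C \<inter> cball a r" for n
    using C x_in bounded by (intro K_minimal closed_Int convex_Int) auto
  have "(\<Inter>n. K n) \<noteq> {}"
  proof (rule decreasing_closed_convex_Inter_nonempty)
    show "closed (K n)" "convex (K n)" "K n \<noteq> {}" for n
      by (auto simp: K_def convex_closure closure_eq_empty)
    show "decseq K"
      unfolding decseq_def K_def by (intro allI impI closure_mono hull_mono image_mono) auto
    show "bounded (K 0)"
      by (rule bounded_subset[OF bounded_cball]) (use K_subset[of 0] in auto)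
  qed
  then obtain w where w: "\<And>n. w \<in> K n"
    by auto
  have "w \<in> fixed_points C T"
  proof (rule fixed_pointI_Minty[OF C(2) T])
    show "w \<in> C"
      using w[of 0] K_subset[of 0] by auto
    fix z assume z: "z \<in> C"
    have bound: "inner (z - T z) (x n - z) \<le> norm (x n - T (x n)) * (r + dist a z)" for n
    proof -
      have "inner (z - T z) (x n - z) \<le> inner (x n - T (x n)) (x n - z)"
        using strict_pseudo_contraction_monotone[OF spc x_in[of n] z] by (simp add: inner_diff_left)
      also have "\<dots> \<le> norm (x n - T (x n)) * norm (x n - z)"
        by (rule norm_cauchy_schwarz)
      also have "\<dots> \<le> norm (x n - T (x n)) * (r + dist a z)"
        using bounded[of n] dist_triangle3[of "x n" z a]
        by (intro mult_left_mono) (auto simp: dist_norm)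
      finally show ?thesis .
    qed
    have "(\<lambda>n. norm (x n - T (x n)) * (r + dist a z)) \<longlonglongrightarrow> norm (0::'a) * (r + dist a z)"
      by (intro tendsto_intros asymp)
    then have lim: "(\<lambda>n. norm (x n - T (x n)) * (r + dist a z)) \<longlonglongrightarrow> 0"
      by simp
    show "inner (z - T z) (w - z) \<le> 0"
    proof (rule field_le_epsilon)
      fix e :: real assume "0 < e"
      then obtain N where N: "\<And>n. N \<le> n \<Longrightarrow> norm (x n - T (x n)) * (r + dist a z) < e"
        using order_tendstoD(2)[OF lim] by (auto simp: eventually_sequentially)
      have "K N \<subseteq> {w. inner (z - T z) w \<le> e + inner (z - T z) z}"
      proof (rule K_minimal)
        fix k assume "N \<le> k"
        then show "x k \<in> {w. inner (z - T z) w \<le> e + inner (z - T z) z}"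
          using N[of k] bound[of k] by (simp add: inner_diff_right)
      qed (rule closed_halfspace_le convex_halfspace_le)+
      then show "inner (z - T z) (w - z) \<le> 0 + e"
        using w[of N] by (auto simp: inner_diff_right)
    qed
  qed
  then show ?thesis
    using K_subset[of 0] w[of 0] by (metis IntD2 mem_cball subsetD)
qed

section \<open>The hybrid projection iteration\<close>

lemma tendsto_zero_if_square_le:
  fixes f g :: "'a \<Rightarrow> real"
  assumes "\<And>n. (f n)\<^sup>2 \<le> g n" and "(g \<longlongrightarrow> 0) F"
  shows "(f \<longlongrightarrow> 0) F"
proof (rule Lim_null_comparison[OF always_eventually])
  show "\<forall>n. norm (f n) \<le> sqrt (g n)"
    using assms(1) by (simp add: real_le_rsqrt)
  show "((\<lambda>n. sqrt (g n)) \<longlongrightarrow> 0) F"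
    using tendsto_real_sqrt[OF assms(2)] by simp
qed

text \<open>
  The upper bound for \<open>a\<close> is the positive root of \<open>\<kappa> L\<^sup>2 t\<^sup>2 + (\<kappa> + 1) t - 1\<close>, rationalized so
  that it stays meaningful when the quadratic term vanishes.
\<close>
lemma step_size_coefficient_pos:
  fixes \<kappa> L a :: real
  assumes "0 \<le> \<kappa>" and "0 < a"
    and "a < 2 / (sqrt (4 * \<kappa> * L\<^sup>2 + (\<kappa> + 1)\<^sup>2) + (\<kappa> + 1))"
  shows "0 < 1 - (\<kappa> + 1) * a - \<kappa> * L\<^sup>2 * a\<^sup>2"
proof -
  define s where "s = sqrt (4 * \<kappa> * L\<^sup>2 + (\<kappa> + 1)\<^sup>2)"
  have s: "0 \<le> s" "s\<^sup>2 = 4 * \<kappa> * L\<^sup>2 + (\<kappa> + 1)\<^sup>2"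
    using assms by (simp_all add: s_def)
  have "a * (s + (\<kappa> + 1)) < 2"
    using assms s(1) unfolding s_def[symmetric] by (simp add: field_simps)
  then have "a * s < 2 - (\<kappa> + 1) * a"
    by (simp add: algebra_simps)
  then have "(a * s)\<^sup>2 < (2 - (\<kappa> + 1) * a)\<^sup>2"
    using s(1) assms by (intro power_strict_mono) auto
  then show ?thesis
    unfolding power_mult_distrib s(2) by (simp add: power2_eq_square algebra_simps)
qed

text \<open>
  With \<open>u = T v - x\<close> one has \<open>y - z = (x - z) + b u\<close>.  After expanding the square, the hypothesis on
  \<open>z\<close> is an inequality with a factor \<open>b\<close> throughout; dividing by \<open>b\<close> leaves
  \<open>a c \<parallel>x - T x\<parallel>\<^sup>2 \<le> 2 \<parallel>u\<parallel> \<parallel>x - z\<parallel>\<close>, and \<open>\<parallel>u\<parallel>\<close> is itself at most a multiple of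
  \<open>\<parallel>x - T x\<parallel>\<close>, so one factor cancels.  The absolute value covers negative \<open>L\<close>, which a singleton
  \<open>C\<close> admits.
\<close>
lemma residual_le_step:
  fixes T :: "'a::real_inner \<Rightarrow> 'a"
  assumes "convex C" and "T \<in> C \<rightarrow> C" and "x \<in> C"
    and Lipschitz: "\<forall>x\<in>C. \<forall>y\<in>C. norm (T x - T y) \<le> L * norm (x - y)"
    and a: "0 \<le> a" "a \<le> 1" and b: "0 < b"
    and v: "v = (1 - a) *\<^sub>R x + a *\<^sub>R T x" and y: "y = (1 - b) *\<^sub>R x + b *\<^sub>R T v"
    and z: "(norm (y - z))\<^sup>2 \<le> (norm (x - z))\<^sup>2 - a * b * c * (norm (x - T x))\<^sup>2"
  shows "a * c * norm (x - T x) \<le> 2 * (1 + \<bar>L\<bar>) * norm (x - z)"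
proof -
  define u where "u = T v - x"
  define g where "g = norm (x - T x)"
  have v_in: "v \<in> C"
    unfolding v using assms by (auto intro!: convexD)
  have "x - v = a *\<^sub>R (x - T x)"
    by (simp add: v algebra_simps)
  then have xv: "norm (v - x) = a * g"
    using a by (metis abs_of_nonneg g_def norm_minus_commute norm_scaleR)
  have "norm u \<le> norm (T v - T x) + g"
    using norm_triangle_ineq[of "T v - T x" "T x - x"]
    by (simp add: u_def g_def norm_minus_commute)
  also have "norm (T v - T x) \<le> L * norm (v - x)"
    using Lipschitz v_in \<open>x \<in> C\<close> by blast
  also have "\<dots> \<le> \<bar>L\<bar> * norm (v - x)"
    by (intro mult_right_mono) auto
  also have "\<dots> \<le> \<bar>L\<bar> * g"
    using a xv by (intro mult_left_mono) (auto simp: g_def mult_left_le_one_le)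
  finally have u: "norm u \<le> (1 + \<bar>L\<bar>) * g"
    by (simp add: algebra_simps)
  have "y - z = (x - z) + b *\<^sub>R u"
    by (simp add: y u_def algebra_simps)
  then have "(norm (y - z))\<^sup>2 = (norm (x - z))\<^sup>2 + b * (2 * inner u (x - z) + b * (norm u)\<^sup>2)"
    by (simp add: power2_norm_eq_inner inner_add_left inner_add_right inner_commute algebra_simps)
  with z have "b * (a * c * g\<^sup>2 + 2 * inner u (x - z) + b * (norm u)\<^sup>2) \<le> 0"
    by (simp add: g_def algebra_simps)
  then have "a * c * g\<^sup>2 + 2 * inner u (x - z) + b * (norm u)\<^sup>2 \<le> 0"
    using b by (simp add: mult_le_0_iff)
  moreover have "0 \<le> b * (norm u)\<^sup>2"
    using b by simp
  moreover have "- inner u (x - z) \<le> norm u * norm (x - z)"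
    using norm_cauchy_schwarz[of "- u" "x - z"] by simp
  moreover have "norm u * norm (x - z) \<le> (1 + \<bar>L\<bar>) * g * norm (x - z)"
    using u by (intro mult_right_mono) auto
  ultimately have "g * (a * c * g) \<le> g * (2 * (1 + \<bar>L\<bar>) * norm (x - z))"
    by (simp add: power2_eq_square algebra_simps)
  then show ?thesis
    unfolding g_def[symmetric] by (cases "g = 0") (auto simp: g_def)
qed

theorem theorem6p3:
  fixes C :: "'a::{real_inner, complete_space} set"
    and T :: "'a \<Rightarrow> 'a"
    and \<kappa> L \<alpha>' \<alpha>'' :: real
    and \<alpha> \<beta> :: "nat \<Rightarrow> real"
    and x\<^sub>0 :: 'a
    and x v y :: "nat \<Rightarrow> 'a"
    and Cn Cstar Q :: "nat \<Rightarrow> 'a set"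
  assumes "C \<noteq> {}" and "closed C" and "convex C"
    and "T \<in> C \<rightarrow> C"
    and "0 \<le> \<kappa>" and "\<kappa> < 1"
    and "strict_pseudo_contraction \<kappa> C T"
    and "fixed_points C T \<noteq> {}"
    and "\<forall>x\<in>C. \<forall>y\<in>C. norm (T x - T y) \<le> L * norm (x - y)"
    and "\<forall>n. \<alpha> n \<in> {0..1}" and "\<forall>n. \<beta> n \<in> {0..1}"
    and "0 < \<alpha>'"
    and "\<forall>n. \<alpha>' \<le> \<alpha> n \<and> \<alpha> n \<le> \<alpha>''"
    and "\<alpha>'' < 2 / (sqrt (4 * \<kappa> * L\<^sup>2 + (\<kappa> + 1)\<^sup>2) + (\<kappa> + 1))"
    and "\<forall>n. 0 < \<beta> n \<and> \<beta> n \<le> \<kappa> * \<alpha> n + (1 - \<kappa>)"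
    and "x\<^sub>0 \<in> C" and "x 0 = x\<^sub>0"
    and "\<forall>n. v n = (1 - \<alpha> n) *\<^sub>R x n + \<alpha> n *\<^sub>R T (x n)"
    and "\<forall>n. y n = (1 - \<beta> n) *\<^sub>R x n + \<beta> n *\<^sub>R T (v n)"
    and "\<forall>n. Cn n = {z \<in> C. (norm (y n - z))\<^sup>2 \<le> (norm (x n - z))\<^sup>2
            - \<alpha> n * \<beta> n * (1 - (\<kappa> + 1) * \<alpha> n - \<kappa> * L\<^sup>2 * (\<alpha> n)\<^sup>2)
              * (norm (x n - T (x n)))\<^sup>2}"
    and "\<forall>n. Q n = {z \<in> C. inner (z - x n) (x n - x\<^sub>0) \<ge> 0}"
    and "\<forall>n. closed (Cstar n) \<and> convex (Cstar n)
            \<and> fixed_points C T \<subseteq> Cstar n \<and> Cstar n \<subseteq> Cn n"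
    and "\<forall>n. x (Suc n) = metric_projection (Cstar n \<inter> Q n) x\<^sub>0"
  shows "metric_projection (fixed_points C T) x\<^sub>0 \<in> fixed_points C T
         \<and> x \<longlonglongrightarrow> metric_projection (fixed_points C T) x\<^sub>0"
proof -
  define F where "F = fixed_points C T"
  define p where "p = metric_projection F x\<^sub>0"
  have x0: "x 0 = x\<^sub>0" and x0_in: "x\<^sub>0 \<in> C"
    using assms by auto
  have x_Suc: "x (Suc n) = metric_projection (Cstar n \<inter> Q n) x\<^sub>0" for n
    using assms by blast
  have Q: "Q n = {z \<in> C. inner (z - x n) (x n - x\<^sub>0) \<ge> 0}" for n
    using assms by blast
  have Cn: "Cn n = {z \<in> C. (norm (y n - z))\<^sup>2 \<le> (norm (x n - z))\<^sup>2
            - \<alpha> n * \<beta> n * (1 - (\<kappa> + 1) * \<alpha> n - \<kappa> * L\<^sup>2 * (\<alpha> n)\<^sup>2)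
              * (norm (x n - T (x n)))\<^sup>2}" for n
    using assms by blast
  have Cstar: "closed (Cstar n)" "convex (Cstar n)" "F \<subseteq> Cstar n" "Cstar n \<subseteq> Cn n" for n
    using assms by (auto simp: F_def)
  have lipschitz: "\<bar>L\<bar>-lipschitz_on C T"
  proof (rule lipschitz_onI)
    fix s t assume "s \<in> C" "t \<in> C"
    then have "norm (T s - T t) \<le> L * norm (s - t)"
      using assms by blast
    also have "\<dots> \<le> \<bar>L\<bar> * norm (s - t)"
      by (intro mult_right_mono) auto
    finally show "dist (T s) (T t) \<le> \<bar>L\<bar> * dist s t"
      by (simp add: dist_norm)
  qed simp
  have cont: "continuous_on C T"
    by (rule lipschitz_on_continuous_on[OF lipschitz])
  have F: "closed F" "convex F" "F \<noteq> {}"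
    using closed_convex_fixed_points[of C T \<kappa>] cont assms unfolding F_def by auto
  have p_in: "p \<in> F" and p_le: "\<And>z. z \<in> F \<Longrightarrow> dist x\<^sub>0 p \<le> dist x\<^sub>0 z"
    using metric_projection[OF F] by (auto simp: p_def)

  have Q_eq: "Q n = C \<inter> {z. inner (x n - x\<^sub>0) z \<ge> inner (x n - x\<^sub>0) (x n)}" for n
    unfolding Q by (auto simp: inner_diff_left inner_diff_right inner_commute)
  have CQ: "closed (Cstar n \<inter> Q n)" "convex (Cstar n \<inter> Q n)" for n
    unfolding Q_eq using Cstar assms
    by (auto intro!: closed_Int convex_Int closed_halfspace_ge convex_halfspace_ge)
  have F_Q: "F \<subseteq> Q n" for n
  proof (induction n)
    case 0
    show ?case
      unfolding Q by (auto simp: x0 F_def fixed_points_def)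
  next
    case (Suc n)
    have "0 \<le> inner (z - x (Suc n)) (x (Suc n) - x\<^sub>0)" if "z \<in> F" for z
      unfolding x_Suc using Suc Cstar(3) that by (intro metric_projection_inner CQ) blast
    then show ?case
      unfolding Q by (auto simp: F_def fixed_points_def)
  qed
  have x_Suc_in: "x (Suc n) \<in> Cstar n \<inter> Q n" for n
  proof -
    have "p \<in> Cstar n \<inter> Q n"
      using F_Q[of n] Cstar(3)[of n] p_in by (auto dest: subsetD)
    then show ?thesis
      unfolding x_Suc by (intro metric_projection_in CQ) auto
  qed
  have x_in: "x n \<in> C" for n
    using x_Suc_in x0_in by (cases n) (auto simp: x0 Q)

  define d where "d n = (norm (x n - x\<^sub>0))\<^sup>2" for n
  have Pythagoras: "(norm (z - x n))\<^sup>2 \<le> (norm (z - x\<^sub>0))\<^sup>2 - d n" if "z \<in> Q n" for z n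
  proof -
    have "(norm (z - x\<^sub>0))\<^sup>2 = (norm (z - x n))\<^sup>2 + d n + 2 * inner (z - x n) (x n - x\<^sub>0)"
      by (simp add: d_def power2_norm_eq_inner inner_diff_left inner_diff_right inner_commute)
    then show ?thesis
      using that by (simp add: Q)
  qed
  have d_step: "(norm (x (Suc n) - x n))\<^sup>2 \<le> d (Suc n) - d n" for n
    using Pythagoras x_Suc_in by (auto simp: d_def)
  have "incseq d"
    by (rule incseq_SucI) (use d_step in \<open>smt (verit) zero_le_power2\<close>)
  have to_p: "(norm (p - x n))\<^sup>2 \<le> (norm (p - x\<^sub>0))\<^sup>2 - d n" for n
    using Pythagoras F_Q p_in by blast
  have "d n \<le> (norm (p - x\<^sub>0))\<^sup>2" for n
    using to_p[of n] zero_le_power2[of "norm (p - x n)"] by linarith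
  then obtain D where D: "d \<longlonglongrightarrow> D" and d_le_D: "\<And>n. d n \<le> D"
    using incseq_convergent[OF \<open>incseq d\<close>] by blast

  have "(\<lambda>n. d (Suc n) - d n) \<longlonglongrightarrow> D - D"
    by (intro tendsto_diff D LIMSEQ_Suc)
  then have "(\<lambda>n. d (Suc n) - d n) \<longlonglongrightarrow> 0"
    by simp
  from tendsto_zero_if_square_le[OF d_step this]
  have step_lim: "(\<lambda>n. norm (x n - x (Suc n))) \<longlonglongrightarrow> 0"
    by (simp add: norm_minus_commute)

  (* The coefficient in the definition of Cn decreases in the step size, so its value at the
     upper bound of the step sizes is a uniform positive lower bound. *)
  define c where "c = 1 - (\<kappa> + 1) * \<alpha>'' - \<kappa> * L\<^sup>2 * \<alpha>''\<^sup>2"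
  have \<alpha>'_pos: "0 < \<alpha>'"
    using assms by simp
  have \<alpha>: "\<alpha>' \<le> \<alpha> n" "\<alpha> n \<le> \<alpha>''" "\<alpha> n \<le> 1" for n
    using assms by auto
  have "0 < \<alpha>''"
    using \<alpha>'_pos \<alpha>[of 0] by linarith
  then have c: "0 < c"
    unfolding c_def using assms by (intro step_size_coefficient_pos) auto
  have residual: "norm (x n - T (x n)) \<le> 2 * (1 + \<bar>L\<bar>) / (\<alpha>' * c) * norm (x n - x (Suc n))" for n
  proof -
    define k where "k = 1 - (\<kappa> + 1) * \<alpha> n - \<kappa> * L\<^sup>2 * (\<alpha> n)\<^sup>2"
    have "(\<alpha> n)\<^sup>2 \<le> \<alpha>''\<^sup>2"
      using \<alpha>'_pos \<alpha>[of n] by (intro power_mono) auto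
    then have "(\<kappa> + 1) * \<alpha> n \<le> (\<kappa> + 1) * \<alpha>''" "\<kappa> * L\<^sup>2 * (\<alpha> n)\<^sup>2 \<le> \<kappa> * L\<^sup>2 * \<alpha>''\<^sup>2"
      using \<alpha>'_pos \<alpha>[of n] assms(5) by (auto intro!: mult_left_mono)
    then have "c \<le> k"
      by (simp add: c_def k_def)
    then have "\<alpha>' * c \<le> \<alpha> n * k"
      using \<alpha>'_pos \<alpha>[of n] c by (intro mult_mono) auto
    then have "\<alpha>' * c * norm (x n - T (x n)) \<le> \<alpha> n * k * norm (x n - T (x n))"
      by (intro mult_right_mono) auto
    also have "\<dots> \<le> 2 * (1 + \<bar>L\<bar>) * norm (x n - x (Suc n))"
    proof (rule residual_le_step[where C = C and b = "\<beta> n" and v = "v n" and y = "y n"])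
      show "(norm (y n - x (Suc n)))\<^sup>2 \<le> (norm (x n - x (Suc n)))\<^sup>2
          - \<alpha> n * \<beta> n * k * (norm (x n - T (x n)))\<^sup>2"
        using x_Suc_in[of n] Cstar(4)[of n] unfolding Cn k_def by blast
    qed (use assms x_in \<alpha>'_pos \<alpha>[of n] in auto)
    finally show ?thesis
      using \<alpha>'_pos \<alpha>[of n] c by (simp add: field_simps)
  qed
  have "(\<lambda>n. 2 * (1 + \<bar>L\<bar>) / (\<alpha>' * c) * norm (x n - x (Suc n))) \<longlonglongrightarrow>
      2 * (1 + \<bar>L\<bar>) / (\<alpha>' * c) * 0"
    by (intro tendsto_intros step_lim)
  then have "(\<lambda>n. 2 * (1 + \<bar>L\<bar>) / (\<alpha>' * c) * norm (x n - x (Suc n))) \<longlonglongrightarrow> 0"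
    by simp
  then have asymp: "(\<lambda>n. x n - T (x n)) \<longlonglongrightarrow> 0"
    by (rule Lim_null_comparison[OF always_eventually[OF allI[OF residual]]])

  (* All iterates stay within the limiting distance sqrt D of the starting point, so some fixed
     point does too; as p is the nearest fixed point, its distance cannot exceed sqrt D. *)
  have "dist x\<^sub>0 (x n) \<le> sqrt D" for n
    using d_le_D[of n] by (simp add: d_def dist_norm norm_minus_commute real_le_rsqrt)
  then obtain w where "w \<in> F" "dist x\<^sub>0 w \<le> sqrt D"
    using approximate_fixed_points_imp_fixed_point[of C T \<kappa> x x\<^sub>0 "sqrt D"]
      cont assms x_in asymp unfolding F_def by auto
  then have "norm (p - x\<^sub>0) \<le> sqrt D"
    using p_le[of w] by (simp add: dist_norm norm_minus_commute)
  then have "(norm (p - x\<^sub>0))\<^sup>2 \<le> (sqrt D)\<^sup>2"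
    by (intro power_mono) auto
  moreover have "0 \<le> D"
    using d_le_D[of 0] by (simp add: d_def x0)
  ultimately have "(dist (x n) p)\<^sup>2 \<le> D - d n" for n
    using to_p[of n] by (simp add: dist_norm norm_minus_commute)
  moreover have "(\<lambda>n. D - d n) \<longlonglongrightarrow> 0"
    using tendsto_diff[OF tendsto_const D, of D] by simp
  ultimately have "(\<lambda>n. dist (x n) p) \<longlonglongrightarrow> 0"
    by (rule tendsto_zero_if_square_le)
  then have "x \<longlonglongrightarrow> p"
    by (simp add: tendsto_dist_iff[of x])
  then show ?thesis
    using p_in by (simp add: p_def F_def)
qed

end
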